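(* If $T$ is a $5$-way $(v,3,2)$ trade, then the volume of $T$ is at least $12$.
   Context: A $(v,k,t)$ trade is a triple $(X;T_1,T_2)$ where $X$ is a $v$-set and $T_1,T_2$ are disjoint nonempty collections of $k$-subsets (blocks) of $X$ such that every $t$-subset of $X$ is contained in the same number of blocks of $T_1$ as of $T_2$. A $\mu$-way $(v,k,t)$ trade is a pair $T=(X,\{T_1,\dots,T_\mu\})$ such that for every $i\neq j$, $(X;T_i,T_j)$ is a $(v,k,t)$ trade. The volume of $T$ is the common number of blocks of the $T_i$. *)

theory Defs
  imports Main "HOL-Library.Multiset"
begin

text \<open>
  The collections of blocks are multisets, since repeated blocks are customary in the theory of
  trades; a simple trade (no repeated blocks) is the special case where all multiplicities are
  at most one.
\<close>

definition trade ::
    "nat \<Rightarrow> nat \<Rightarrow> nat \<Rightarrow> 'a set \<Rightarrow> 'a set multiset \<Rightarrow> 'a set multiset \<Rightarrow> bool" where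
  "trade v k t X T1 T2 \<longleftrightarrow>
     finite X \<and> card X = v \<and>
     T1 \<noteq> {#} \<and> T2 \<noteq> {#} \<and>
     set_mset T1 \<inter> set_mset T2 = {} \<and>
     (\<forall>B. B \<in># T1 \<or> B \<in># T2 \<longrightarrow> B \<subseteq> X \<and> card B = k) \<and>
     (\<forall>S. S \<subseteq> X \<and> card S = t \<longrightarrow>
        size {#B \<in># T1. S \<subseteq> B#} = size {#B \<in># T2. S \<subseteq> B#})"

text \<open>
  The \<open>\<mu>\<close> collections form a family of which only the values at \<open>1, \<dots>, \<mu>\<close> matter.  They are
  automatically distinct for \<open>\<mu> \<ge> 2\<close>, being nonempty and pairwise disjoint.
\<close>

definition mway_trade ::
    "nat \<Rightarrow> nat \<Rightarrow> nat \<Rightarrow> nat \<Rightarrow> 'a set \<Rightarrow> (nat \<Rightarrow> 'a set multiset) \<Rightarrow> bool" where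
  "mway_trade \<mu> v k t X T \<longleftrightarrow>
     (\<forall>i\<in>{1..\<mu>}. \<forall>j\<in>{1..\<mu>}. i \<noteq> j \<longrightarrow> trade v k t X (T i) (T j))"

text \<open>
  The common number of blocks, counted with multiplicity; for \<open>t \<le> k\<close>, double counting the
  pairs of a \<open>t\<close>-subset and a block containing it shows that it exists.
\<close>

definition volume :: "nat \<Rightarrow> (nat \<Rightarrow> 'a set multiset) \<Rightarrow> nat" where
  "volume \<mu> T = (THE m. \<forall>i\<in>{1..\<mu>}. size (T i) = m)"

end

theory Submission
  imports Defs
begin

text \<open>
  Let \<open>L x y\<close> be the number of blocks of any \<open>T i\<close> through the pair \<open>x y\<close> and \<open>R x\<close> the number of
  blocks through \<open>x\<close>.  The five sets of third points of a pair are disjoint, which gives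
  \<open>3 * L x y \<le> R x\<close>: every point has \<open>R x \<ge> 3\<close> and at least six neighbours, and if \<open>R x < 6\<close> then it
  has exactly \<open>2 * R x\<close> neighbours, each of them joined to it once.  If the volume is at most 11,
  then the \<open>R x\<close> sum to at most 33, some \<open>R x\<close> is 3, and the closed neighbourhood \<open>F\<close> of such a point
  is a clique of size 7.  Counting the points outside \<open>F\<close> leaves two cases: \<open>F\<close> is everything, where
  the \<open>T i\<close> would be five disjoint Fano planes, or the covered pairs form \<open>K\<^sub>9\<close> minus a triangle.
  Neither admits five disjoint decompositions into triples.
\<close>

section \<open>Double counting over multisets\<close>

lemma sum_size_filter_mset:
  assumes "finite A"
  shows "(\<Sum>y\<in>A. size {#B \<in># M. P y B#}) = (\<Sum>B\<in>#M. card {y \<in> A. P y B})"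
proof (induction M)
  case (add B M)
  have "(\<Sum>y\<in>A. size {#C \<in># add_mset B M. P y C#})
      = (\<Sum>y\<in>A. size {#C \<in># M. P y C#} + (if P y B then 1 else 0))"
    by (intro sum.cong) auto
  also have "\<dots> = (\<Sum>C\<in>#add_mset B M. card {y \<in> A. P y C})"
    using assms add by (simp add: sum.distrib sum.If_cases Int_def)
  finally show ?case .
qed simp

lemma size_filter_mset_conv_sum:
  "size {#B \<in># M. P B#} = (\<Sum>B\<in>#M. if P B then 1 else 0)"
proof (induction M)
  case (add B M)
  then show ?case
    by (cases "P B") (simp_all only: filter_mset_add_mset image_mset_add_mset sum_mset.add_mset
      size_add_mset if_True if_False)
qed simp

text \<open>At most one summand is positive. In the intended use the summands are the multiplicities
  of one triple in the five disjoint collections.\<close>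

lemma sum_disjoint_support_le:
  fixes f :: "'b \<Rightarrow> nat"
  assumes "finite S" "\<And>i j. i \<in> S \<Longrightarrow> j \<in> S \<Longrightarrow> f i > 0 \<Longrightarrow> f j > 0 \<Longrightarrow> i = j"
    and "\<And>i. i \<in> S \<Longrightarrow> f i \<le> b"
  shows "(\<Sum>i\<in>S. f i) \<le> b"
proof (cases "\<exists>i\<in>S. f i > 0")
  case True
  then obtain i where i: "i \<in> S" "f i > 0" by blast
  have "f j = (if j = i then f i else 0)" if "j \<in> S" for j
    using assms(2)[OF that i(1)] i(2) by (cases "f j") auto
  then have "(\<Sum>j\<in>S. f j) = (\<Sum>j\<in>S. if j = i then f i else 0)" by (intro sum.cong refl)
  then show ?thesis using assms(1) assms(3)[OF i(1)] i(1) by simp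
qed simp

lemma card_3_with_two_elements:
  assumes "card B = 3" "x \<in> B" "y \<in> B" "x \<noteq> y"
  obtains z where "z \<noteq> x" "z \<noteq> y" "B = {x, y, z}"
proof -
  have "finite B" using assms(1) card.infinite by fastforce
  then have "card (B - {x, y}) = 1" using assms by (subst card_Diff_subset) auto
  then obtain z where "B - {x, y} = {z}" by (auto simp: card_1_singleton_iff)
  then show ?thesis using assms that[of z] by blast
qed

section \<open>Pair and point degrees of a five-way trade\<close>

locale five_way_trade =
  fixes X :: "'a set" and T :: "nat \<Rightarrow> 'a set multiset"
  assumes finite_X: "finite X"
    and block_subset: "i \<in> {1..5} \<Longrightarrow> B \<in># T i \<Longrightarrow> B \<subseteq> X"
    and block_card: "i \<in> {1..5} \<Longrightarrow> B \<in># T i \<Longrightarrow> card B = 3"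
    and disjoint: "i \<in> {1..5} \<Longrightarrow> j \<in> {1..5} \<Longrightarrow> B \<in># T i \<Longrightarrow> B \<in># T j \<Longrightarrow> i = j"
    and balanced: "i \<in> {1..5} \<Longrightarrow> j \<in> {1..5} \<Longrightarrow> S \<subseteq> X \<Longrightarrow> card S = 2 \<Longrightarrow>
        size {#B \<in># T i. S \<subseteq> B#} = size {#B \<in># T j. S \<subseteq> B#}"
    and nonempty: "T 1 \<noteq> {#}"
begin

text \<open>On the diagonal the count would be \<open>R x\<close>; the value 0 keeps
  \<open>x\<close> out of \<open>N x\<close> and out of sums over \<open>X\<close>.\<close>

definition L :: "'a \<Rightarrow> 'a \<Rightarrow> nat" where
  "L x y = (if x = y then 0 else size {#B \<in># T 1. x \<in> B \<and> y \<in> B#})"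

definition R :: "'a \<Rightarrow> nat" where
  "R x = size {#B \<in># T 1. x \<in> B#}"

definition N :: "'a \<Rightarrow> 'a set" where
  "N x = {y. L x y > 0}"

text \<open>The foundation of the trade: \<open>X\<close> may also have points on no block.\<close>

definition V :: "'a set" where
  "V = {x. R x > 0}"

lemma finite_block: "i \<in> {1..5} \<Longrightarrow> B \<in># T i \<Longrightarrow> finite B"
  using block_subset finite_X finite_subset by blast

lemma L_sym: "L x y = L y x"
  by (auto simp: L_def conj_commute)

text \<open>Balance speaks only of pairs inside \<open>X\<close>; a pair with a point outside lies
  in no block, so both counts vanish.\<close>

lemma L_eq:
  assumes "i \<in> {1..5}" "x \<noteq> y"
  shows "size {#B \<in># T i. x \<in> B \<and> y \<in> B#} = L x y"
proof (cases "x \<in> X \<and> y \<in> X")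
  case True
  then show ?thesis using balanced[OF assms(1), of 1 "{x, y}"] assms by (simp add: L_def)
next
  case False
  then have "size {#B \<in># T j. x \<in> B \<and> y \<in> B#} = 0" if "j \<in> {1..5}" for j
    using block_subset[OF that] by auto
  from this[OF assms(1)] this[of 1] show ?thesis
    unfolding L_def using assms(2) by (simp only: if_False) simp
qed

text \<open>Each block through \<open>x\<close> is counted once for each of its two other
  points.\<close>

lemma sum_L:
  assumes "i \<in> {1..5}"
  shows "(\<Sum>y\<in>X. L x y) = 2 * size {#B \<in># T i. x \<in> B#}"
proof -
  have "(\<Sum>y\<in>X. L x y) = (\<Sum>y\<in>X. size {#B \<in># T i. y \<noteq> x \<and> x \<in> B \<and> y \<in> B#})"
    by (intro sum.cong refl) (use L_eq[OF assms] in \<open>auto simp: L_def\<close>)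
  also have "\<dots> = (\<Sum>B\<in>#T i. card {y \<in> X. y \<noteq> x \<and> x \<in> B \<and> y \<in> B})"
    by (rule sum_size_filter_mset[OF finite_X])
  also have "\<dots> = (\<Sum>B\<in>#T i. 2 * (if x \<in> B then 1 else 0))"
  proof (intro arg_cong[where f = sum_mset] image_mset_cong)
    fix B assume B: "B \<in># T i"
    then have "{y \<in> X. y \<noteq> x \<and> x \<in> B \<and> y \<in> B} = (if x \<in> B then B - {x} else {})"
      using block_subset[OF assms] by auto
    then show "card {y \<in> X. y \<noteq> x \<and> x \<in> B \<and> y \<in> B} = 2 * (if x \<in> B then 1 else 0)"
      using block_card[OF assms B] finite_block[OF assms B] by simp
  qed
  also have "\<dots> = 2 * size {#B \<in># T i. x \<in> B#}"
    by (simp add: size_filter_mset_conv_sum sum_mset_distrib_left)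
  finally show ?thesis .
qed

text \<open>Balance passes from pairs to points: by \<open>sum_L\<close>, twice the count is a sum
  of values \<open>L x y\<close>, which do not depend on \<open>i\<close>.\<close>

lemma R_eq: "i \<in> {1..5} \<Longrightarrow> size {#B \<in># T i. x \<in> B#} = R x"
  using sum_L[of i x] sum_L[of 1 x] by (simp add: R_def)

lemma sum_L_R: "(\<Sum>y\<in>X. L x y) = 2 * R x"
  using sum_L[of 1 x] by (simp add: R_def)

lemma sum_R:
  assumes "i \<in> {1..5}"
  shows "(\<Sum>x\<in>X. R x) = 3 * size (T i)"
proof -
  have "(\<Sum>x\<in>X. R x) = (\<Sum>x\<in>X. size {#B \<in># T i. x \<in> B#})"
    using R_eq[OF assms] by simp
  also have "\<dots> = (\<Sum>B\<in>#T i. card {x \<in> X. x \<in> B})"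
    by (rule sum_size_filter_mset[OF finite_X])
  also have "\<dots> = (\<Sum>B\<in>#T i. 3)"
  proof (intro arg_cong[where f = sum_mset] image_mset_cong)
    fix B assume B: "B \<in># T i"
    then have "{x \<in> X. x \<in> B} = B" using block_subset[OF assms] by auto
    then show "card {x \<in> X. x \<in> B} = 3" using block_card[OF assms B] by simp
  qed
  finally show ?thesis by simp
qed

lemma size_eq: "i \<in> {1..5} \<Longrightarrow> size (T i) = size (T 1)"
  using sum_R[of i] sum_R[of 1] by simp

lemma volume_eq: "volume 5 T = size (T 1)"
  unfolding volume_def
proof (rule the_equality)
  show "\<forall>i\<in>{1..5}. size (T i) = size (T 1)" using size_eq by blast
next
  fix m assume "\<forall>i\<in>{1..5}. size (T i) = m"
  then show "m = size (T 1)" by force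
qed

text \<open>Sorting the blocks through \<open>x y\<close> by their third point exposes the
  multiplicities to which disjointness applies.\<close>

lemma L_eq_sum_count:
  assumes i: "i \<in> {1..5}" and xy: "x \<noteq> y"
  shows "L x y = (\<Sum>z\<in>X - {x, y}. count (T i) {x, y, z})"
proof -
  have "(\<Sum>z\<in>X - {x, y}. count (T i) {x, y, z})
      = (\<Sum>z\<in>X - {x, y}. size {#B \<in># T i. B = {x, y, z}#})"
    by (simp add: count_conv_size_mset)
  also have "\<dots> = (\<Sum>B\<in>#T i. card {z \<in> X - {x, y}. B = {x, y, z}})"
    by (rule sum_size_filter_mset) (simp add: finite_X)
  also have "\<dots> = (\<Sum>B\<in>#T i. if x \<in> B \<and> y \<in> B then 1 else 0)"
  proof (intro arg_cong[where f = sum_mset] image_mset_cong)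
    fix B assume B: "B \<in># T i"
    show "card {z \<in> X - {x, y}. B = {x, y, z}} = (if x \<in> B \<and> y \<in> B then 1 else 0)"
    proof (cases "x \<in> B \<and> y \<in> B")
      case True
      then obtain w where w: "w \<noteq> x" "w \<noteq> y" "B = {x, y, w}"
        using card_3_with_two_elements block_card[OF i B] xy by metis
      then have "{z \<in> X - {x, y}. B = {x, y, z}} = {w}"
        using block_subset[OF i B] by (auto simp: doubleton_eq_iff)
      then show ?thesis using True by simp
    qed (auto simp: card_eq_0_iff)
  qed
  also have "\<dots> = L x y"
    using L_eq[OF i xy] by (simp add: size_filter_mset_conv_sum)
  finally show ?thesis by simp
qed

text \<open>A point \<open>z\<close> completes the pair \<open>x y\<close> to a block of at most one \<open>T i\<close>, and there at most
  \<open>L x z\<close> times, so \<open>5 * L x y\<close> is at most the sum of \<open>L x z\<close> over the other points \<open>z\<close>.\<close>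

lemma three_L_le_R: "3 * L x y \<le> R x"
proof (cases "x = y \<or> y \<notin> X")
  case True
  have "L x y = 0"
  proof (cases "x = y")
    case False
    with True block_subset[of 1] show ?thesis by (auto simp: L_def filter_mset_eq_mempty_iff)
  qed (simp add: L_def)
  then show ?thesis by simp
next
  case False
  let ?Y = "X - {x, y}"
  have "5 * L x y = (\<Sum>i\<in>{1..5::nat}. \<Sum>z\<in>?Y. count (T i) {x, y, z})"
    using False by (subst sum.cong[OF refl L_eq_sum_count[symmetric]]) auto
  also have "\<dots> = (\<Sum>z\<in>?Y. \<Sum>i\<in>{1..5}. count (T i) {x, y, z})"
    by (rule sum.swap)
  also have "\<dots> \<le> (\<Sum>z\<in>?Y. L x z)"
  proof (intro sum_mono sum_disjoint_support_le)
    show "finite {1..5::nat}" by simp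
    show "i = j" if "i \<in> {1..5}" "j \<in> {1..5}" "count (T i) {x, y, z} > 0"
      "count (T j) {x, y, z} > 0" for i j z
      using disjoint[OF that(1,2)] that(3,4) by (simp add: count_greater_zero_iff)
    fix i z assume i: "i \<in> {1..5::nat}" and z: "z \<in> ?Y"
    have "count (T i) {x, y, z} = size {#B \<in># T i. B = {x, y, z}#}"
      by (simp add: count_conv_size_mset)
    also have "\<dots> \<le> size {#B \<in># T i. x \<in> B \<and> z \<in> B#}"
      by (rule size_mset_mono, rule filter_mset_mono_strong) auto
    also have "\<dots> = L x z" using z by (intro L_eq[OF i]) auto
    finally show "count (T i) {x, y, z} \<le> L x z" .
  qed
  \<comment> \<open>Adding the missing term \<open>L x y\<close> completes the right side to the sum
    over all other points, which is at most \<open>2 * R x\<close>.\<close>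
  finally have "6 * L x y \<le> L x y + (\<Sum>z\<in>?Y. L x z)" by simp
  also have "\<dots> = (\<Sum>z\<in>X - {x}. L x z)"
  proof -
    have "X - {x} = insert y ?Y" using False by auto
    then show ?thesis using finite_X by simp
  qed
  also have "\<dots> \<le> (\<Sum>z\<in>X. L x z)"
    by (intro sum_mono2) (auto simp: finite_X)
  finally show ?thesis by (simp add: sum_L_R)
qed

section \<open>Neighbourhoods and third points\<close>

lemma N_sym: "y \<in> N x \<longleftrightarrow> x \<in> N y"
  by (simp add: N_def L_sym)

lemma not_in_N [simp]: "x \<notin> N x"
  by (simp add: N_def L_def)

lemma V_subset: "V \<subseteq> X"
proof
  fix x assume "x \<in> V"
  then have "R x \<noteq> 0" by (simp add: V_def)
  then obtain B where "B \<in># T 1" "x \<in> B" by (auto simp: R_def)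
  then show "x \<in> X" using block_subset[of 1 B] by auto
qed

lemma finite_V: "finite V"
  using V_subset finite_X finite_subset by blast

lemma N_subset: "N x \<subseteq> V - {x}"
proof
  fix y assume y: "y \<in> N x"
  then have "3 * L y x \<le> R y" "L y x > 0" using three_L_le_R L_sym[of x y] by (auto simp: N_def)
  then show "y \<in> V - {x}" using y by (auto simp: V_def)
qed

lemma finite_N: "finite (N x)"
  using N_subset finite_V by (metis finite_Diff finite_subset)

lemma block_N:
  assumes "i \<in> {1..5}" "B \<in># T i" "x \<in> B" "y \<in> B" "x \<noteq> y"
  shows "y \<in> N x"
proof -
  have "size {#B \<in># T i. x \<in> B \<and> y \<in> B#} \<noteq> 0"
    using assms by auto
  then show ?thesis unfolding L_eq[OF assms(1,5)] by (simp add: N_def)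
qed

lemma ex_third:
  assumes "i \<in> {1..5}" "y \<in> N x"
  shows "\<exists>z. z \<noteq> x \<and> z \<noteq> y \<and> z \<in> N x \<and> z \<in> N y \<and> {x, y, z} \<in># T i"
proof -
  have ne: "x \<noteq> y" using assms(2) by auto
  then have "size {#B \<in># T i. x \<in> B \<and> y \<in> B#} \<noteq> 0"
    using L_eq[OF assms(1) ne] assms(2) by (simp add: N_def)
  then obtain B where B: "B \<in># T i" "x \<in> B" "y \<in> B"
    by auto
  then obtain z where "z \<noteq> x" "z \<noteq> y" "B = {x, y, z}"
    using card_3_with_two_elements[OF block_card[OF assms(1)]] ne by metis
  with B show ?thesis using block_N[OF assms(1) B(1)] by blast
qed

lemma unique_third:
  assumes "i \<in> {1..5}" "L x y \<le> 1" "{x, y, z} \<in># T i" "{x, y, w} \<in># T i" "x \<noteq> y"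
    and "z \<noteq> x" "z \<noteq> y"
  shows "z = w"
proof (rule ccontr)
  assume "z \<noteq> w"
  \<comment> \<open>Being neither \<open>x\<close> nor \<open>y\<close>, the point \<open>z\<close>
    lies in the first block only.\<close>
  then have ne: "{x, y, z} \<noteq> {x, y, w}" using assms by blast
  have "{#{x, y, z}, {x, y, w}#} \<subseteq># {#B \<in># T i. x \<in> B \<and> y \<in> B#}"
    using assms ne by (auto simp: insert_subset_eq_iff in_diff_count)
  then have "2 \<le> size {#B \<in># T i. x \<in> B \<and> y \<in> B#}"
    using size_mset_mono by fastforce
  then show False using L_eq[OF assms(1,5)] assms(2) by simp
qed

text \<open>A third point shared by two of the \<open>T i\<close> would give them a common block, so
  any choice of third points is injective.\<close>

lemma third_family:
  assumes "y \<in> N x"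
  obtains f where "inj_on f {1..5::nat}" "f ` {1..5} \<subseteq> N x - {y}"
    "\<And>i. i \<in> {1..5} \<Longrightarrow> {x, y, f i} \<in># T i"
proof -
  have "\<forall>i\<in>{1..5}. \<exists>z. z \<in> N x - {y} \<and> {x, y, z} \<in># T i"
    using ex_third[OF _ assms] by blast
  then obtain f where f: "\<And>i. i \<in> {1..5} \<Longrightarrow> f i \<in> N x - {y} \<and> {x, y, f i} \<in># T i"
    by metis
  have "inj_on f {1..5}" by (rule inj_onI) (metis f disjoint)
  then show ?thesis using f that by blast
qed

text \<open>Five distinct third points of a pair \<open>x y\<close>, together with \<open>y\<close>,
  are six neighbours of \<open>x\<close>.\<close>

lemma card_N_ge: "x \<in> V \<Longrightarrow> card (N x) \<ge> 6"
proof -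
  assume "x \<in> V"
  then have "(\<Sum>y\<in>X. L x y) \<noteq> 0" by (simp add: sum_L_R V_def)
  then obtain y where y: "y \<in> N x"
    unfolding N_def by (metis gr0I mem_Collect_eq sum.neutral)
  then obtain f where "inj_on f {1..5::nat}" "f ` {1..5} \<subseteq> N x - {y}"
    by (rule third_family)
  then have "card {1..5::nat} \<le> card (N x - {y})"
    using finite_N by (intro card_inj_on_le) auto
  then show ?thesis using y finite_N by simp
qed

lemma R_ge: "x \<in> V \<Longrightarrow> R x \<ge> 3"
proof -
  assume "x \<in> V"
  then have "N x \<noteq> {}" using card_N_ge by fastforce
  then obtain y where "L x y > 0" by (auto simp: N_def)
  then show ?thesis using three_L_le_R[of x y] by linarith
qed

lemma L_le_1: "R x < 6 \<Longrightarrow> L x y \<le> 1"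
  using three_L_le_R[of x y] by linarith

lemma sum_L_N: "(\<Sum>y\<in>N x. L x y) = 2 * R x"
proof -
  have "N x \<subseteq> X" using N_subset[of x] V_subset by blast
  then have "(\<Sum>y\<in>N x. L x y) = (\<Sum>y\<in>X. L x y)"
    by (intro sum.mono_neutral_left finite_X) (auto simp: N_def)
  then show ?thesis by (simp only: sum_L_R)
qed

lemma L_eq_1: "R x < 6 \<Longrightarrow> y \<in> N x \<Longrightarrow> L x y = 1"
  using L_le_1[of x y] by (auto simp: N_def)

lemma card_N_eq: "R x < 6 \<Longrightarrow> card (N x) = 2 * R x"
  using sum_L_N[of x] sum.cong[OF refl, of "N x" "L x" "\<lambda>_. 1"] L_eq_1[of x] by simp

text \<open>The five third points of \<open>x y\<close> exhaust the five neighbours of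
  \<open>x\<close> other than \<open>y\<close>, so \<open>z\<close> is one of them.\<close>

lemma covered:
  assumes "card (N x) = 6" "y \<in> N x" "z \<in> N x" "y \<noteq> z"
  shows "\<exists>i\<in>{1..5}. {x, y, z} \<in># T i"
proof -
  obtain f where f: "inj_on f {1..5::nat}" "f ` {1..5} \<subseteq> N x - {y}"
    "\<And>i. i \<in> {1..5} \<Longrightarrow> {x, y, f i} \<in># T i"
    using third_family[OF assms(2)] by blast
  have "f ` {1..5} = N x - {y}"
    using assms f card_image[OF f(1)] finite_N by (intro card_subset_eq) auto
  then have "z \<in> f ` {1..5}" using assms by blast
  then show ?thesis using f(3) by blast
qed

section \<open>Existence of a point of degree three\<close>

lemma sum_R_V: "(\<Sum>x\<in>V. R x) = 3 * size (T 1)"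
proof -
  have "(\<Sum>x\<in>V. R x) = (\<Sum>x\<in>X. R x)"
    by (intro sum.mono_neutral_left) (use finite_X V_subset in \<open>auto simp: V_def\<close>)
  then show ?thesis using sum_R[of 1] by simp
qed

text \<open>If all degrees are at least 4, the degree sum of at most 33 allows at most 8 points.
  Degree 4 or 5 would need at least 8 neighbours, so all degrees are at least 6 and at most 5 points
  remain, too few for six neighbours.\<close>

lemma ex_R_eq_3:
  assumes "size (T 1) \<le> 11"
  shows "\<exists>x\<in>V. R x = 3"
proof (rule ccontr)
  assume "\<not> ?thesis"
  then have ge4: "R x \<ge> 4" if "x \<in> V" for x using R_ge[OF that] that by fastforce
  have sum: "(\<Sum>x\<in>V. R x) \<le> 33" using sum_R_V assms by simp
  have "4 * card V \<le> (\<Sum>x\<in>V. R x)" using sum_bounded_below[of V 4 R] ge4 by simp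
  with sum have card8: "card V \<le> 8" by simp
  have ge6: "R x \<ge> 6" if "x \<in> V" for x
  proof (rule ccontr)
    assume "\<not> ?thesis"
    then have "card (N x) \<ge> 8" using card_N_eq[of x] ge4[OF that] by simp
    moreover have "card (N x) \<le> card (V - {x})"
      using N_subset finite_V by (intro card_mono) auto
    ultimately show False using card8 that finite_V by simp
  qed
  have "6 * card V \<le> (\<Sum>x\<in>V. R x)" using sum_bounded_below[of V 6 R] ge6 by simp
  with sum have card5: "card V \<le> 5" by simp
  have "V \<noteq> {}" using sum_R_V nonempty by auto
  then obtain x where "x \<in> V" by blast
  then have "6 \<le> card (N x)" by (rule card_N_ge)
  also have "\<dots> \<le> card V" using N_subset finite_V by (intro card_mono) auto
  finally show False using card5 by simp
qed

section \<open>The two extremal configurations\<close>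

text \<open>Call two points of \<open>B\<close> mates in \<open>T i\<close> if their block
  lies in \<open>B\<close>.  Then \<open>T i\<close> splits \<open>B\<close> into two classes of three mates, and every pair is mated
  in exactly two of the five \<open>T i\<close>.  If \<open>a b c\<close> is a block, then two of the other \<open>T i\<close> mate \<open>a\<close>
  neither with \<open>b\<close> nor with \<open>c\<close>, so \<open>b\<close> and \<open>c\<close> are mated three times.\<close>

lemma no_K9_minus_triangle:
  assumes B: "card B = 6" and W: "card W = 3" and disj: "B \<inter> W = {}"
    and NB: "\<And>y. y \<in> B \<Longrightarrow> N y = B \<union> W - {y}" and NW: "\<And>w. w \<in> W \<Longrightarrow> N w = B"
    and L1: "\<And>x y. L x y \<le> 1"
  shows False
proof -
  have fin: "finite B" "finite W" using B W card.infinite by fastforce+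
  define mate where "mate i p q \<longleftrightarrow> (\<exists>r\<in>B. r \<noteq> p \<and> r \<noteq> q \<and> {p, q, r} \<in># T i)" for i p q
  have uniq: "r = s" if "{p, q, r} \<in># T i" "{p, q, s} \<in># T i" "i \<in> {1..5}" "p \<noteq> q"
      "r \<noteq> p" "r \<noteq> q" for i p q r s
    using unique_third[OF that(3) L1 that(1,2,4-6)] .
  have third: "\<exists>r\<in>B \<union> W. r \<noteq> p \<and> r \<noteq> q \<and> {p, q, r} \<in># T i"
    if "p \<in> B" "q \<in> B" "p \<noteq> q" "i \<in> {1..5}" for p q i
    using ex_third[of i q p] NB that by blast
  \<comment> \<open>Each \<open>w\<close> in \<open>W\<close> completes \<open>p q\<close> to a
    block of some \<open>T i\<close>, different \<open>w\<close> in different \<open>T i\<close>. In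
    the two remaining \<open>T i\<close> the third point lies in \<open>B\<close>.\<close>
  have mates: "card {i\<in>{1..5}. mate i p q} = 2" if pq: "p \<in> B" "q \<in> B" "p \<noteq> q" for p q
  proof -
    have "\<exists>i\<in>{1..5}. {p, q, w} \<in># T i" if "w \<in> W" for w
      using covered[of w p q] NW[OF that] pq B by (simp add: insert_commute)
    then obtain g where g: "\<And>w. w \<in> W \<Longrightarrow> g w \<in> {1..5} \<and> {p, q, w} \<in># T (g w)" by metis
    have "inj_on g W"
    proof (rule inj_onI)
      fix w w' assume w: "w \<in> W" "w' \<in> W" "g w = g w'"
      then have "w \<noteq> p" "w \<noteq> q" using pq disj by auto
      then show "w = w'" using uniq[of p q w "g w" w'] g[OF w(1)] g[OF w(2)] w(3) pq by simp
    qed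
    then have card3: "card (g ` W) = 3" using W by (simp add: card_image)
    have "{i\<in>{1..5}. mate i p q} = {1..5} - g ` W"
    proof (intro equalityI subsetI DiffI)
      fix i assume i: "i \<in> {i\<in>{1..5}. mate i p q}"
      then show "i \<in> {1..5}" by simp
      show "i \<notin> g ` W"
      proof
        assume "i \<in> g ` W"
        then obtain w where w: "w \<in> W" "i = g w" by blast
        obtain r where r: "r \<in> B" "r \<noteq> p" "r \<noteq> q" "{p, q, r} \<in># T i"
          using i mate_def by auto
        have "r = w" using uniq[OF r(4), of w] g[OF w(1)] w(2) i pq r by simp
        then show False using r w disj by blast
      qed
    next
      fix i assume i: "i \<in> {1..5} - g ` W"
      obtain r where r: "r \<in> B \<union> W" "r \<noteq> p" "r \<noteq> q" "{p, q, r} \<in># T i"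
        using third pq i by blast
      have "r \<notin> W"
      proof
        assume "r \<in> W"
        then have "i = g r" using g[of r] disjoint[of i "g r"] r(4) i by blast
        then show False using i \<open>r \<in> W\<close> by blast
      qed
      then show "i \<in> {i\<in>{1..5}. mate i p q}" using r i by (auto simp: mate_def)
    qed
    moreover have "g ` W \<subseteq> {1..5}" using g by auto
    ultimately show ?thesis using card3 fin by (simp add: card_Diff_subset)
  qed
  have mate_sym: "mate i p q \<longleftrightarrow> mate i q p" for i p q
    by (auto simp: mate_def insert_commute)
  \<comment> \<open>The blocks of \<open>T i\<close> through \<open>a\<close> and the points of
    \<open>W\<close> use up three further points of \<open>B\<close>. The two points left over can
    only form a block with \<open>a\<close> together.\<close>
  have own: "\<exists>b c. b \<noteq> c \<and> {a, b, c} \<in># T i \<and> {q \<in> B - {a}. mate i a q} = {b, c}"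
    if a: "a \<in> B" and i: "i \<in> {1..5}" for a i
  proof -
    have "\<exists>r\<in>B. r \<noteq> a \<and> {a, r, w} \<in># T i" if w: "w \<in> W" for w
    proof -
      obtain r where "r \<in> N w" "r \<noteq> a" "{w, a, r} \<in># T i"
        using ex_third[OF i, of a w] NW[OF w] a by blast
      moreover have "{w, a, r} = {a, r, w}" by auto
      ultimately show ?thesis using NW[OF w] by auto
    qed
    then obtain g where g: "\<And>w. w \<in> W \<Longrightarrow> g w \<in> B \<and> g w \<noteq> a \<and> {a, g w, w} \<in># T i" by metis
    have "inj_on g W"
    proof (rule inj_onI)
      fix w w' assume w: "w \<in> W" "w' \<in> W" "g w = g w'"
      then have "w \<noteq> a" "w \<noteq> g w" using g[OF w(1)] a disj by auto
      then show "w = w'" using uniq[of a "g w" w i w'] g[OF w(1)] g[OF w(2)] w i by auto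
    qed
    then have "card (g ` W) = 3" using W by (simp add: card_image)
    then have "card (B - {a} - g ` W) = 2"
      using g B a fin by (subst card_Diff_subset) auto
    then obtain b c where bc: "B - {a} - g ` W = {b, c}" "b \<noteq> c" by (auto simp: card_2_iff)
    have mate_iff: "mate i a q \<longleftrightarrow> q \<in> {b, c}" if q: "q \<in> B" "q \<noteq> a" for q
    proof
      assume "mate i a q"
      then obtain r where r: "r \<in> B" "r \<noteq> a" "r \<noteq> q" "{a, q, r} \<in># T i" by (auto simp: mate_def)
      have "q \<notin> g ` W"
      proof
        assume "q \<in> g ` W"
        then obtain w where "w \<in> W" "q = g w" by blast
        then have "r = w" using uniq[OF r(4)] g[of w] r i q by auto
        then show False using r \<open>w \<in> W\<close> disj by blast
      qed
      then show "q \<in> {b, c}" using q bc by blast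
    next
      assume "q \<in> {b, c}"
      then have q': "q \<notin> g ` W" using bc by blast
      obtain r where r: "r \<in> B \<union> W" "r \<noteq> a" "r \<noteq> q" "{a, q, r} \<in># T i"
        using third[OF a q(1) _ i] q by metis
      have "r \<notin> W"
      proof
        assume "r \<in> W"
        with g[of r] have gr: "{a, g r, r} \<in># T i" "g r \<noteq> q" "g r \<noteq> a" "g r \<noteq> r"
          using q' disj by auto
        have "{a, r, g r} \<in># T i" "{a, r, q} \<in># T i"
          using gr(1) r(4) by (simp_all add: insert_commute)
        then show False using uniq[of a r "g r" i q] gr i r by auto
      qed
      then show "mate i a q" using r by (auto simp: mate_def)
    qed
    have b: "b \<in> B" "b \<noteq> a" using bc by blast+
    then obtain r where r: "r \<in> B" "r \<noteq> a" "r \<noteq> b" "{a, b, r} \<in># T i"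
      using mate_iff[of b] by (auto simp: mate_def)
    then have "mate i a r" using b by (auto simp: mate_def insert_commute)
    then have "r = c" using mate_iff r by blast
    moreover have "{q \<in> B - {a}. mate i a q} = {b, c}" using mate_iff bc(1) by blast
    ultimately show ?thesis using r bc by blast
  qed
  \<comment> \<open>The class of \<open>a\<close> is \<open>{a, m, n}\<close>. The class of
    \<open>b\<close> avoids it, so it is the rest of \<open>B\<close>, which contains
    \<open>c\<close>.\<close>
  have split: "mate i b c"
    if abc: "a \<in> B" "b \<in> B" "c \<in> B" "a \<noteq> b" "a \<noteq> c" "b \<noteq> c" and i: "i \<in> {1..5}"
      and no: "\<not> mate i a b" "\<not> mate i a c" for a b c i
  proof -
    obtain m n where mn: "m \<noteq> n" "{a, m, n} \<in># T i" "{q \<in> B - {a}. mate i a q} = {m, n}"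
      using own abc i by metis
    obtain p q where pq: "p \<noteq> q" "{b, p, q} \<in># T i" "{r \<in> B - {b}. mate i b r} = {p, q}"
      using own abc i by metis
    have mnB: "m \<in> B" "n \<in> B" "a \<noteq> m" "a \<noteq> n" "mate i a m" "mate i a n" using mn by blast+
    then have mne: "m \<noteq> b" "m \<noteq> c" "n \<noteq> b" "n \<noteq> c" using no by auto
    have mate_mn: "mate i m n"
      unfolding mate_def
    proof (intro bexI conjI)
      show "{m, n, a} \<in># T i" using mn(2) by (simp add: insert_commute)
    qed (use mnB abc in auto)
    have card2: "card {q \<in> B - {x}. mate i x q} = 2" if x: "x \<in> B" for x
    proof -
      obtain p q where "p \<noteq> q" "{q \<in> B - {x}. mate i x q} = {p, q}" using own[OF x i] by blast
      then show ?thesis by simp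
    qed
    have "\<not> mate i b x" if x: "x \<in> {m, n}" for x
    proof
      assume bx: "mate i b x"
      \<comment> \<open>The other one of \<open>m\<close> and \<open>n\<close>: \<open>x\<close>
        would have the three mates \<open>a\<close>, \<open>y\<close>, \<open>b\<close>.\<close>
      define y where "y = (if x = m then n else m)"
      have "mate i x a" using x mnB mate_sym by blast
      moreover have "mate i x y" using x mate_mn mate_sym[of i m n] by (auto simp: y_def)
      moreover have "mate i x b" using bx mate_sym by blast
      ultimately have "{a, y, b} \<subseteq> {q \<in> B - {x}. mate i x q}"
        using x mn(1) mnB mne abc by (auto simp: y_def)
      then have "card {a, y, b} \<le> 2"
        using card2[of x] x mnB fin card_mono[of "{q \<in> B - {x}. mate i x q}" "{a, y, b}"] by auto
      moreover have "card {a, y, b} = 3" using mnB mne abc by (auto simp: y_def)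
      ultimately show False by simp
    qed
    then have "{p, q} \<subseteq> B - {a, b, m, n}"
      using pq(3) no(1) mate_sym[of i a b] by blast
    moreover have "card (B - {a, b, m, n}) = 2"
      using B abc mnB mne mn(1) fin by (subst card_Diff_subset) auto
    ultimately have "{p, q} = B - {a, b, m, n}"
      using pq(1) fin by (intro card_subset_eq) auto
    then show ?thesis using pq(3) abc mne by blast
  qed
  have "B \<noteq> {}" using B by auto
  then obtain a where a: "a \<in> B" by blast
  obtain b c where "b \<noteq> c" "{a, b, c} \<in># T 1" "{q \<in> B - {a}. mate 1 a q} = {b, c}"
    using own[OF a, of 1] by auto
  then have bc: "b \<in> B" "c \<in> B" "a \<noteq> b" "a \<noteq> c" "b \<noteq> c" "{a, b, c} \<in># T 1" by blast+
  let ?M = "\<lambda>p q. {i\<in>{1..5}. mate i p q}"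
  have "mate 1 a b" "mate 1 a c" "mate 1 b c"
    using a bc by (auto simp: mate_def insert_commute)
  then have "1 \<in> ?M a b" "1 \<in> ?M a c" "1 \<in> ?M b c" by auto
  then have c1: "card (?M a b - {1}) = 1" "card (?M a c - {1}) = 1" "card (?M b c - {1}) = 1"
    using mates a bc by simp_all
  \<comment> \<open>Apart from index 1 each pair of \<open>a b c\<close> is mated once, so three
    singletons would have to cover four indices.\<close>
  have "{2..5} \<subseteq> (?M a b - {1}) \<union> (?M a c - {1}) \<union> (?M b c - {1})"
  proof
    fix i :: nat assume "i \<in> {2..5}"
    then have i: "i \<in> {1..5}" "i \<noteq> 1" by auto
    then have "mate i a b \<or> mate i a c \<or> mate i b c" using split[OF a bc(1-5) i(1)] by blast
    then show "i \<in> (?M a b - {1}) \<union> (?M a c - {1}) \<union> (?M b c - {1})" using i by blast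
  qed
  then have "card {2..5::nat} \<le> card ((?M a b - {1}) \<union> (?M a c - {1}) \<union> (?M b c - {1}))"
    by (intro card_mono) auto
  also have "\<dots> \<le> card (?M a b - {1}) + card (?M a c - {1}) + card (?M b c - {1})"
    by (intro order.trans[OF card_Un_le] add_right_mono card_Un_le)
  finally show False using c1 by simp
qed

text \<open>The blocks of \<open>T 1\<close> and \<open>T 2\<close> through \<open>x\<close> form a hexagon \<open>a b c d e f\<close> on the other points.
  Let \<open>T k\<close> be the plane with the block \<open>x a d\<close>.  The remaining blocks of \<open>T 1\<close> are determined by
  the one through \<open>a c\<close>; either choice forces blocks of \<open>T 2\<close> that leave some pair without a third
  point in \<open>T k\<close>.\<close>

lemma no_disjoint_Fano_planes:
  assumes card: "card V = 7" and NV: "\<And>x. x \<in> V \<Longrightarrow> N x = V - {x}"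
    and L1: "\<And>x y. L x y \<le> 1"
  shows False
proof -
  \<comment> \<open>The choice is unique by \<open>t_eqI\<close>, since each pair lies in at most
    one block of \<open>T i\<close>.\<close>
  define t where "t i p q = (SOME r. r \<noteq> p \<and> r \<noteq> q \<and> {p, q, r} \<in># T i)" for i p q
  have t: "t i p q \<noteq> p \<and> t i p q \<noteq> q \<and> {p, q, t i p q} \<in># T i \<and> t i p q \<in> V"
    if "p \<in> V" "q \<in> V" "p \<noteq> q" "i \<in> {1..5}" for i p q
  proof -
    have "\<exists>r. r \<noteq> p \<and> r \<noteq> q \<and> {p, q, r} \<in># T i"
      using ex_third[of i q p] NV that by blast
    then have *: "t i p q \<noteq> p \<and> t i p q \<noteq> q \<and> {p, q, t i p q} \<in># T i"
      unfolding t_def by (rule someI_ex)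
    then have "t i p q \<in> N p" using block_N[OF that(4), of "{p, q, t i p q}" p "t i p q"] by force
    with * show ?thesis using N_subset by blast
  qed
  have t_eqI: "t i p q = r"
    if "{p, q, r} \<in># T i" "p \<in> V" "q \<in> V" "p \<noteq> q" "i \<in> {1..5}" for i p q r
    using unique_third[OF that(5) L1 _ that(1,4)] t[OF that(2-5)] by blast
  have sym: "t i q p = t i p q" if "p \<in> V" "q \<in> V" "p \<noteq> q" "i \<in> {1..5}" for i p q
    using t_eqI[of q p "t i p q" i] t[OF that] that by (simp add: insert_commute)
  have inv: "t i p (t i p q) = q" "t i q (t i p q) = p"
    if "p \<in> V" "q \<in> V" "p \<noteq> q" "i \<in> {1..5}" for i p q
    using t_eqI[of p "t i p q" q i] t_eqI[of q "t i p q" p i] t[OF that] that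
    by (force simp: insert_commute)+
  have neq: "t i p q \<noteq> t j p q"
    if "p \<in> V" "q \<in> V" "p \<noteq> q" "i \<in> {1..5}" "j \<in> {1..5}" "i \<noteq> j" for i j p q
    using t[of p q i] t[of p q j] disjoint[of i j] that by metis
  have cover: "\<exists>i\<in>{1..5}. t i p q = r"
    if "p \<in> V" "q \<in> V" "r \<in> V" "p \<noteq> q" "p \<noteq> r" "q \<noteq> r" for p q r
  proof -
    have "\<exists>i\<in>{1..5}. {p, q, r} \<in># T i"
      using covered[of p q r] NV card finite_V that by simp
    then show ?thesis using t_eqI that by blast
  qed
  \<comment> \<open>All six equations are recorded so that simplification can use a block from any
    of its ordered pairs.\<close>
  define blk where "blk i p q r \<longleftrightarrow> t i p q = r \<and> t i q p = r \<and> t i p r = q \<and> t i r p = q \<and>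
    t i q r = p \<and> t i r q = p" for i p q r
  have blkI: "blk i p q r"
    if "t i p q = r" "p \<in> V" "q \<in> V" "p \<noteq> q" "i \<in> {1..5}" for i p q r
    using inv[OF that(2-5)] sym[OF that(2-5)] t[OF that(2-5)] that sym[of p r i] sym[of q r i]
    by (auto simp: blk_def)
  have I: "1 \<in> {1..5::nat}" "2 \<in> {1..5::nat}" by auto
  obtain x where x: "x \<in> V" using card by fastforce
  have "card (V - {x}) = 6" using card x by simp
  then have "V - {x} \<noteq> {}" by force
  then obtain a where a: "a \<in> V" "a \<noteq> x" by blast
  \<comment> \<open>The hexagon is walked from \<open>a\<close> by alternating between the partners
    with respect to \<open>x\<close> in \<open>T 1\<close> and in \<open>T 2\<close>.\<close>
  define b where "b = t 1 x a"
  have b: "b \<in> V" "b \<noteq> x" "b \<noteq> a" using t[of x a 1] x a by (auto simp: b_def)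
  note xab = blkI[OF b_def[symmetric] x a(1) a(2)[symmetric] I(1)]
  define c where "c = t 2 x b"
  have c: "c \<in> V" "c \<noteq> x" "c \<noteq> b" using t[of x b 2] x b by (auto simp: c_def)
  note xbc = blkI[OF c_def[symmetric] x b(1) b(2)[symmetric] I(2)]
  have ca: "c \<noteq> a" using neq[of x b 1 2] xab xbc x a b I by (auto simp: blk_def)
  define d where "d = t 1 x c"
  have d: "d \<in> V" "d \<noteq> x" "d \<noteq> c" using t[of x c 1] x c by (auto simp: d_def)
  note xcd = blkI[OF d_def[symmetric] x c(1) c(2)[symmetric] I(1)]
  have da: "d \<noteq> a" "d \<noteq> b" using xab xcd c ca by (auto simp: blk_def)
  define e where "e = t 2 x d"
  have e: "e \<in> V" "e \<noteq> x" "e \<noteq> d" using t[of x d 2] x d by (auto simp: e_def)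
  note xde = blkI[OF e_def[symmetric] x d(1) d(2)[symmetric] I(2)]
  have eb: "e \<noteq> b" "e \<noteq> c" using xbc xde d da by (auto simp: blk_def)
  \<comment> \<open>If the walk closed after four points, the two points left over would be partners
    in both \<open>T 1\<close> and \<open>T 2\<close>.\<close>
  have ea: "e \<noteq> a"
  proof
    assume ea: "e = a"
    have "card (V - {x, a, b, c, d}) = 2"
      using card x a b c d ca da finite_V by (subst card_Diff_subset) auto
    then obtain u w where uw: "V - {x, a, b, c, d} = {u, w}" "u \<noteq> w" by (auto simp: card_2_iff)
    then have V: "V = {x, a, b, c, d, u, w}" using x a b c d by auto
    have u: "u \<in> V" "u \<noteq> x" "u \<notin> {a, b, c, d}" using uw by blast+
    have "t 1 x u = w"
      using t[of x u 1] inv[of x u 1] x u I xab xcd unfolding V blk_def by auto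
    moreover have "t 2 x u = w"
      using t[of x u 2] inv[of x u 2] x u I xbc xde ea unfolding V blk_def by auto
    ultimately show False using neq[of x u 1 2] x u I by auto
  qed
  have "card (V - {x, a, b, c, d, e}) = 1"
    using card x a b c d e ca da eb ea finite_V by (subst card_Diff_subset) auto
  then obtain f where f: "V - {x, a, b, c, d, e} = {f}" by (auto simp: card_1_singleton_iff)
  then have V: "V = {x, a, b, c, d, e, f}" using x a b c d e by auto
  have in_V: "x \<in> V" "a \<in> V" "b \<in> V" "c \<in> V" "d \<in> V" "e \<in> V" "f \<in> V" using V by auto
  have "f \<notin> {x, a, b, c, d, e}" using f by blast
  then have dist: "distinct [x, a, b, c, d, e, f]" using a b c d e ca da eb ea by auto
  have third: "t i p q \<in> {x, a, b, c, d, e, f} - {p, q}"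
    if "p \<in> V" "q \<in> V" "p \<noteq> q" "i \<in> {1..5}" for i p q
    using t[OF that] V by blast
  have xef: "blk 1 x e f"
    by (rule blkI) (use third[of x e 1] inv[of x e 1] in_V dist I xab xcd in
      \<open>auto simp: blk_def\<close>)
  have xfa: "blk 2 x f a"
    by (rule blkI) (use third[of x f 2] inv[of x f 2] in_V dist I xbc xde in
      \<open>auto simp: blk_def\<close>)
  obtain k where k: "k \<in> {1..5}" "t k x a = d" using cover[of x a d] in_V dist by auto
  have xad: "blk k x a d" by (rule blkI) (use k in_V dist in auto)
  have k12: "k \<noteq> 1" "k \<noteq> 2" using k xab xfa dist by (auto simp: blk_def)
  \<comment> \<open>Otherwise, in the plane \<open>T l\<close> with the block \<open>x a c\<close>,
    the point \<open>e\<close> has no partner: \<open>f\<close>, \<open>d\<close> and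
    \<open>b\<close> are its partners in \<open>T 1\<close>, \<open>T 2\<close> and
    \<open>T k\<close>.\<close>
  have "t k x b \<noteq> e"
  proof
    assume "t k x b = e"
    then have xbe: "blk k x b e" by (rule blkI) (use k in_V dist in auto)
    obtain l where l: "l \<in> {1..5}" "t l x a = c" using cover[of x a c] in_V dist by auto
    have xac: "blk l x a c" by (rule blkI) (use l in_V dist in auto)
    have l12: "l \<noteq> 1" "l \<noteq> 2" "l \<noteq> k" using l xab xfa xad dist by (auto simp: blk_def)
    show False
      using third[of x e l] inv[of x e l] neq[of x e l 1] neq[of x e l 2] neq[of x e l k] in_V dist I
        l(1) k(1) l12 xef xde xbe xac
      by (auto simp: blk_def)
  qed
  have xbf: "blk k x b f"
    by (rule blkI) (use third[of x b k] inv[of x b k] neq[of x b k 2] in_V dist I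
      k(1) k12 \<open>t k x b \<noteq> e\<close> xad xbc in
      \<open>auto simp: blk_def\<close>)
  have xce: "blk k x c e"
    by (rule blkI) (use third[of x c k] inv[of x c k] in_V dist I k(1) xad xbf in
      \<open>auto simp: blk_def\<close>)
  have "t 1 a c = e \<or> t 1 a c = f"
    using third[of a c 1] inv[of a c 1] in_V dist I xab xcd by (auto simp: blk_def)
  then show False
  proof
    assume "t 1 a c = e"
    then have ace: "blk 1 a c e" by (rule blkI) (use in_V dist I in auto)
    have adf: "blk 1 a d f"
      by (rule blkI) (use third[of a d 1] inv[of a d 1] in_V dist I xab xcd ace in
        \<open>auto simp: blk_def\<close>)
    have bde: "blk 1 b d e"
      by (rule blkI) (use third[of b d 1] inv[of b d 1] in_V dist I xab xcd adf in
        \<open>auto simp: blk_def\<close>)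
    have acd: "blk 2 a c d"
      by (rule blkI) (use third[of a c 2] inv[of a c 2] neq[of a c 2 1] in_V dist I xbc xfa ace in
        \<open>auto simp: blk_def\<close>)
    have aeb: "blk 2 a e b"
      by (rule blkI) (use third[of a e 2] inv[of a e 2] in_V dist I xfa xde acd in
        \<open>auto simp: blk_def\<close>)
    \<comment> \<open>For the pair \<open>b e\<close> in \<open>T k\<close>, the points
      \<open>x\<close>, \<open>c\<close>, \<open>f\<close> are excluded by blocks of
      \<open>T k\<close>, and \<open>d\<close> and \<open>a\<close> by \<open>T 1\<close> and
      \<open>T 2\<close>.\<close>
    show False
      using third[of b e k] inv[of b e k] neq[of b e k 1] neq[of b e k 2] in_V dist I
        k(1) k12 xbf xce bde aeb
      by (auto simp: blk_def)
  next
    assume "t 1 a c = f"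
    then have acf: "blk 1 a c f" by (rule blkI) (use in_V dist I in auto)
    have ceb: "blk 1 c e b"
      by (rule blkI) (use third[of c e 1] inv[of c e 1] in_V dist I xcd xef acf in
        \<open>auto simp: blk_def\<close>)
    have bdf: "blk 1 b d f"
      by (rule blkI) (use third[of b d 1] inv[of b d 1] in_V dist I xab xcd ceb in
        \<open>auto simp: blk_def\<close>)
    have bda: "blk 2 b d a"
      by (rule blkI) (use third[of b d 2] inv[of b d 2] neq[of b d 2 1] in_V dist I xbc xde bdf in
        \<open>auto simp: blk_def\<close>)
    have cdf: "blk 2 c d f"
      by (rule blkI) (use third[of c d 2] inv[of c d 2] in_V dist I xbc xde bda in
        \<open>auto simp: blk_def\<close>)
    \<comment> \<open>Likewise for \<open>c f\<close>: blocks of \<open>T k\<close> exclude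
      \<open>x\<close>, \<open>e\<close>, \<open>b\<close>, while \<open>T 1\<close> and
      \<open>T 2\<close> exclude \<open>a\<close> and \<open>d\<close>.\<close>
    show False
      using third[of c f k] inv[of c f k] neq[of c f k 1] neq[of c f k 2] in_V dist I
        k(1) k12 xce xbf acf cdf
      by (auto simp: blk_def)
  qed
qed

section \<open>Degree counting around a point of degree three\<close>

lemma size_ge_12: "size (T 1) \<ge> 12"
proof (rule ccontr)
  assume "\<not> ?thesis"
  then have m: "size (T 1) \<le> 11" by simp
  obtain x0 where x0: "x0 \<in> V" "R x0 = 3" using ex_R_eq_3[OF m] by blast
  have N0: "card (N x0) = 6" using card_N_eq[of x0] x0 by simp
  define F where "F = insert x0 (N x0)"
  have F: "card F = 7" "finite F" using N0 finite_N by (simp_all add: F_def)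
  have FV: "F \<subseteq> V" using N_subset x0 by (auto simp: F_def)
  have clique: "F - {p} \<subseteq> N p" if p: "p \<in> F" for p
  proof
    fix q assume q: "q \<in> F - {p}"
    show "q \<in> N p"
    proof (cases "p = x0 \<or> q = x0")
      case True
      then show ?thesis using p q N_sym by (auto simp: F_def)
    next
      case False
      then have "p \<in> N x0" "q \<in> N x0" "p \<noteq> q" using p q by (auto simp: F_def)
      then obtain i where "i \<in> {1..5}" "{x0, p, q} \<in># T i" using covered[OF N0] by blast
      then show ?thesis using block_N[of i "{x0, p, q}" p q] \<open>p \<noteq> q\<close> by blast
    qed
  qed
  \<comment> \<open>The points of \<open>A\<close> have all their six neighbours inside the clique
    \<open>F\<close>, so points of \<open>Z\<close> are joined only to \<open>B\<close> and
    \<open>Z\<close>.\<close>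
  define A where "A = {x \<in> F. R x = 3}"
  define B where "B = F - A"
  define Z where "Z = V - F"
  have fin: "finite A" "finite B" "finite Z" using F finite_V by (auto simp: A_def B_def Z_def)
  have AF: "A \<subseteq> F" by (auto simp: A_def)
  have BV: "B \<subseteq> V" using FV by (auto simp: B_def)
  have x0A: "x0 \<in> A" using x0 by (auto simp: A_def F_def)
  have ab: "card A + card B = 7"
    using F AF fin card_mono[OF F(2) AF] by (simp add: B_def card_Diff_subset)
  have a1: "card A \<ge> 1" using x0A fin by (metis One_nat_def Suc_leI card_gt_0_iff empty_iff)
  have V_eq: "V = A \<union> B \<union> Z" using FV AF by (auto simp: B_def Z_def)
  have disj: "A \<inter> B = {}" "(A \<union> B) \<inter> Z = {}" using AF by (auto simp: B_def Z_def)
  have cV: "card V = 7 + card Z"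
    using ab fin disj by (simp add: V_eq card_Un_disjoint)
  have sum3: "(\<Sum>x\<in>A. R x) + (\<Sum>x\<in>B. R x) + (\<Sum>x\<in>Z. R x) = 3 * size (T 1)"
    using fin disj unfolding sum_R_V[symmetric] V_eq by (simp add: sum.union_disjoint)
  have sumA: "(\<Sum>x\<in>A. R x) = 3 * card A" by (simp add: A_def)
  have B4: "R y \<ge> 4" if "y \<in> B" for y
  proof -
    have "R y \<ge> 3" "R y \<noteq> 3" using R_ge that BV by (auto simp: B_def A_def)
    then show ?thesis by simp
  qed
  have Z3: "R z \<ge> 3" if "z \<in> Z" for z using R_ge that by (auto simp: Z_def)
  have NA: "N y = F - {y}" if "y \<in> A" for y
  proof -
    have y: "y \<in> F" "R y = 3" using that by (auto simp: A_def)
    then have "card (F - {y}) = card (N y)" using card_N_eq[of y] F by simp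
    then show ?thesis using card_subset_eq[OF finite_N clique[OF y(1)]] by simp
  qed
  have NZ: "N z \<subseteq> B \<union> Z - {z}" if z: "z \<in> Z" for z
  proof -
    have "p \<notin> N z" if "p \<in> A" for p
      using NA[OF that] z N_sym[of p z] by (auto simp: Z_def)
    then show ?thesis using N_subset[of z] V_eq by blast
  qed
  have cN: "card (N x) + 1 \<le> card V" if "x \<in> V" for x
  proof -
    have "card (N x) \<le> card (V - {x})" using finite_V by (intro card_mono N_subset) auto
    moreover have "card V > 0" using that finite_V card_gt_0_iff by blast
    ultimately show ?thesis using that finite_V by simp
  qed
  \<comment> \<open>Degree 4 or 5 would need at least 8 neighbours, but at most 7 other points
    exist.\<close>
  have R6: "R x \<ge> 6" if "x \<in> V" "R x \<ge> 4" "card V \<le> 8" for x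
    using cN[OF that(1)] card_N_eq[of x] that by linarith
  have sumB: "4 * card B \<le> (\<Sum>x\<in>B. R x)" using sum_bounded_below[of B 4 R] B4 by simp
  have sumZ: "3 * card Z \<le> (\<Sum>x\<in>Z. R x)" using sum_bounded_below[of Z 3 R] Z3 by simp
  have Zcard: "card B + card Z \<ge> 7" and ZN: "\<And>z. z \<in> Z \<Longrightarrow> card (N z) + 1 \<le> card B + card Z"
    if "Z \<noteq> {}"
  proof -
    show *: "card (N z) + 1 \<le> card B + card Z" if z: "z \<in> Z" for z
    proof -
      have "card (N z) \<le> card (B \<union> Z - {z})" using fin by (intro card_mono NZ[OF z]) auto
      moreover have "card (B \<union> Z) = card B + card Z"
        using fin disj by (intro card_Un_disjoint) auto
      moreover have "card Z > 0" using z fin by (auto simp: card_gt_0_iff)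
      ultimately show ?thesis using z fin by simp
    qed
    obtain z where z: "z \<in> Z" using \<open>Z \<noteq> {}\<close> by blast
    then have "card (N z) \<ge> 6" using card_N_ge by (auto simp: Z_def)
    then show "card B + card Z \<ge> 7" using *[OF z] by simp
  qed
  \<comment> \<open>The degree sum gives \<open>card B + 3 * card Z \<le> 12\<close>; subtracting
    \<open>card B + card Z \<ge> 7\<close> leaves \<open>2 * card Z \<le> 5\<close>.\<close>
  have "card Z \<le> 2"
  proof (cases "Z = {}")
    case False
    then show ?thesis using Zcard sum3 sumA sumB sumZ ab m by linarith
  qed simp
  then consider "card Z = 0" | "card Z = 1" | "card Z = 2" by linarith
  then show False
  proof cases
    case 1
    then have Z: "Z = {}" using fin by simp
    have B6: "R y \<ge> 6" if "y \<in> B" for y using R6[of y] B4[OF that] that BV cV 1 by auto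
    have "6 * card B \<le> (\<Sum>x\<in>B. R x)" using sum_bounded_below[of B 6 R] B6 by simp
    then have b4: "card B \<le> 4" using sum3 sumA ab m by linarith
    have VF: "V = F" using Z FV by (auto simp: Z_def)
    have LA: "L x y = 1" if "x \<in> A" "y \<in> F" "x \<noteq> y" for x y
      using L_eq_1[of x y] NA[OF that(1)] that by (auto simp: A_def)
    show False
    proof (cases "B = {}")
      case True
      then have "A = F" using AF by (auto simp: B_def)
      show False
      proof (rule no_disjoint_Fano_planes)
        show "card V = 7" using F VF by simp
        show "N x = V - {x}" if "x \<in> V" for x using NA \<open>A = F\<close> VF that by simp
        show "L x y \<le> 1" for x y
        proof (cases "x \<in> V")
          case True
          then have "x \<in> A" using \<open>A = F\<close> VF by simp
          then show ?thesis using L_le_1[of x y] by (simp add: A_def)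
        next
          case False
          then show ?thesis using three_L_le_R[of x y] by (simp add: V_def)
        qed
      qed
    next
      case False
      then obtain y where y: "y \<in> B" by blast
      have yF: "y \<in> F" "y \<notin> A" using y by (auto simp: B_def)
      \<comment> \<open>If \<open>y\<close> were alone in \<open>B\<close>, it would be joined at
        most once to each of the six points of \<open>A\<close>, giving
        \<open>R y \<le> 3\<close>.\<close>
      have b2: "card B \<ge> 2"
      proof (rule ccontr)
        assume "\<not> ?thesis"
        moreover have "card B \<noteq> 0" using y fin by auto
        ultimately have "card B = 1" by linarith
        then have "B = {y}" using y by (auto simp: card_1_singleton_iff)
        then have NyA: "N y \<subseteq> A" using N_subset[of y] VF by (auto simp: B_def)
        have "2 * R y = (\<Sum>x\<in>N y. L y x)" by (rule sum_L_N[symmetric])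
        also have "\<dots> \<le> (\<Sum>x\<in>A. L y x)" using NyA fin by (intro sum_mono2) auto
        also have "\<dots> = (\<Sum>x\<in>A. 1)"
          using LA yF L_sym by (intro sum.cong refl) metis
        finally show False using B6[OF y] ab by simp
      qed
      \<comment> \<open>Otherwise every block of \<open>T i\<close> through \<open>y\<close> meets
        \<open>A\<close>. Each point of \<open>A\<close> is on only one such block, so
        \<open>R y \<le> card A \<le> 5\<close>.\<close>
      have in_B: "\<exists>C. {y} \<union> C \<in># T i \<and> C \<subseteq> B - {y} \<and> card C = 2" if i: "i \<in> {1..5}" for i
      proof -
        have "\<exists>C. C \<in># T i \<and> y \<in> C \<and> C \<subseteq> B"
        proof (rule ccontr)
          assume no: "\<not> ?thesis"
          have meets: "(if y \<in> C then 1 else 0) \<le> card {x \<in> A. x \<in> C \<and> y \<in> C}"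
            if C: "C \<in># T i" for C
          proof (cases "y \<in> C")
            case True
            have "C \<subseteq> F" using block_N[OF i C True] N_subset[of y] VF yF(1) by blast
            then obtain x where "x \<in> C" "x \<in> A" using no C True unfolding B_def by blast
            then have "{x \<in> A. x \<in> C \<and> y \<in> C} \<noteq> {}" using True by blast
            then have "card {x \<in> A. x \<in> C \<and> y \<in> C} > 0" using fin by (simp add: card_gt_0_iff)
            then show ?thesis using True by simp
          qed simp
          have "R y = (\<Sum>C\<in>#T i. if y \<in> C then 1 else 0)"
            using R_eq[OF i, of y] by (simp only: size_filter_mset_conv_sum)
          also have "\<dots> \<le> (\<Sum>C\<in>#T i. card {x \<in> A. x \<in> C \<and> y \<in> C})"
            by (intro sum_mset_mono meets)
          also have "\<dots> = (\<Sum>x\<in>A. size {#C \<in># T i. x \<in> C \<and> y \<in> C#})"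
            by (rule sum_size_filter_mset[OF fin(1), symmetric])
          also have "\<dots> = (\<Sum>x\<in>A. 1)"
          proof (intro sum.cong refl)
            fix x assume x: "x \<in> A"
            then have "x \<noteq> y" using yF by auto
            then show "size {#C \<in># T i. x \<in> C \<and> y \<in> C#} = 1"
              using L_eq[OF i] LA[OF x yF(1)] by simp
          qed
          finally show False using B6[OF y] b2 ab by simp
        qed
        then obtain C where C: "C \<in># T i" "y \<in> C" "C \<subseteq> B" by blast
        then have "card (C - {y}) = 2" using block_card[OF i C(1)] finite_block[OF i C(1)] by simp
        moreover have "{y} \<union> (C - {y}) = C" using C by auto
        ultimately show ?thesis using C by (intro exI[of _ "C - {y}"]) auto
      qed
      then obtain g where g: "\<And>i. i \<in> {1..5} \<Longrightarrow>
          {y} \<union> g i \<in># T i \<and> g i \<subseteq> B - {y} \<and> card (g i) = 2" by metis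
      have "inj_on g {1..5}" by (rule inj_onI) (metis g disjoint)
      moreover have "g ` {1..5} \<subseteq> {C. C \<subseteq> B - {y} \<and> card C = 2}" using g by blast
      ultimately have "card {1..5::nat} \<le> card {C. C \<subseteq> B - {y} \<and> card C = 2}"
        using fin by (intro card_inj_on_le) auto
      also have "\<dots> = card (B - {y}) choose 2" using fin by (intro n_subsets) auto
      \<comment> \<open>The five \<open>T i\<close> need five different pairs in
        \<open>B - {y}\<close>, but at most three points give at most three pairs.\<close>
      finally have "5 \<le> card (B - {y}) choose 2" by simp
      moreover have "card (B - {y}) \<in> {0, 1, 2, 3}" using b4 y fin by auto
      ultimately show False by (auto simp: choose_two)
    qed
  next
    case 2
    then have "Z \<noteq> {}" by auto
    then have b6: "card B \<ge> 6" using Zcard 2 by simp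
    have B6: "R y \<ge> 6" if "y \<in> B" for y using R6[of y] B4[OF that] that BV cV 2 by auto
    have "6 * card B \<le> (\<Sum>x\<in>B. R x)" using sum_bounded_below[of B 6 R] B6 by simp
    then show False using b6 sum3 sumA sumZ ab m 2 by linarith
  next
    case 3
    then have Zne: "Z \<noteq> {}" by auto
    have b: "card B \<ge> 5" "card B \<le> 6" using Zcard[OF Zne] 3 ab a1 by auto
    \<comment> \<open>The degree sum exceeds its lower bound \<open>27 + card B\<close> by at most
      1. A degree above 3 in \<open>Z\<close> would be at least 6, as \<open>z\<close> has at most 7
      neighbours.\<close>
    have RZ: "R z = 3" if z: "z \<in> Z" for z
    proof (rule ccontr)
      assume "R z \<noteq> 3"
      then have "R z \<ge> 4" using Z3[OF z] by simp
      then have z6: "R z \<ge> 6" using ZN[OF Zne z] card_N_eq[of z] 3 b by linarith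
      have "(\<Sum>x\<in>Z. R x) = R z + (\<Sum>x\<in>Z - {z}. R x)" using z fin by (simp add: sum.remove)
      moreover have "3 * card (Z - {z}) \<le> (\<Sum>x\<in>Z - {z}. R x)"
        using sum_bounded_below[of "Z - {z}" 3 R] Z3 by simp
      moreover have "card (Z - {z}) = 1" using z 3 fin by simp
      ultimately show False using z6 sum3 sumA sumB ab m b by linarith
    qed
    then have sumZ6: "(\<Sum>x\<in>Z. R x) = 6" using 3 by simp
    \<comment> \<open>Degree 5 would need 10 neighbours among 8 other points, and degree 6 exceeds
      the bound by 2.\<close>
    have RB: "R y = 4" if y: "y \<in> B" for y
    proof (rule ccontr)
      assume "R y \<noteq> 4"
      then have "R y \<ge> 5" using B4[OF y] by simp
      then have y6: "R y \<ge> 6" using cN[of y] card_N_eq[of y] y BV cV 3 by fastforce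
      have "(\<Sum>x\<in>B. R x) = R y + (\<Sum>x\<in>B - {y}. R x)" using y fin by (simp add: sum.remove)
      moreover have "4 * card (B - {y}) \<le> (\<Sum>x\<in>B - {y}. R x)"
        using sum_bounded_below[of "B - {y}" 4 R] B4 by simp
      moreover have "card (B - {y}) = card B - 1" using y fin by simp
      ultimately show False using y6 sum3 sumA sumZ6 ab m b by linarith
    qed
    then have "(\<Sum>x\<in>B. R x) = 4 * card B" by simp
    then have "3 * card A + 4 * card B + 6 = 3 * size (T 1)" using sum3 sumA sumZ6 by simp
    \<comment> \<open>The degree sum is \<open>27 + card B\<close>, a multiple of 3.\<close>
    with ab b have b6: "card B = 6" by presburger
    then have "card A = 1" using ab by simp
    \<comment> \<open>The missing triangle: three points of degree 3 joined exactly to the six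
      points of \<open>B\<close>.\<close>
    define W where "W = insert x0 Z"
    have A_eq: "A = {x0}" using x0A \<open>card A = 1\<close> by (auto simp: card_1_singleton_iff)
    have VBW: "V = B \<union> W" using V_eq A_eq by (auto simp: W_def)
    have NB: "N y = B \<union> W - {y}" if y: "y \<in> B" for y
    proof -
      have "card (N y) = 8" using card_N_eq[of y] RB[OF y] by simp
      moreover have "card (V - {y}) = 8" using cV 3 y BV finite_V by (subst card_Diff_singleton) auto
      ultimately have "N y = V - {y}" using finite_V by (intro card_subset_eq N_subset) auto
      then show ?thesis using VBW by simp
    qed
    have BW: "B \<inter> W = {}" using disj x0A by (auto simp: W_def)
    show False
    proof (rule no_K9_minus_triangle[OF b6 _ BW NB])
      have "x0 \<notin> Z" using disj x0A by blast
      then show "card W = 3" using 3 fin by (simp add: W_def)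
      show "N w = B" if w: "w \<in> W" for w
      proof -
        have "R w = 3" using w x0 RZ by (auto simp: W_def)
        then have "card (N w) = card B" using card_N_eq[of w] b6 by simp
        moreover have "B \<subseteq> N w" using NB w BW N_sym by blast
        ultimately show ?thesis using card_subset_eq[OF finite_N, of B w] by simp
      qed
      show "L x y \<le> 1" for x y
      proof -
        have "R x < 6"
          using RB RZ x0 VBW by (cases "x \<in> V") (auto simp: W_def V_def)
        then show ?thesis by (rule L_le_1)
      qed
    qed
  qed
qed

end

theorem theorem3p6:
  fixes v :: nat and X :: "'a set" and T :: "nat \<Rightarrow> 'a set multiset"
  assumes "mway_trade 5 v 3 2 X T"
  shows "volume 5 T \<ge> 12"
proof -
  have trade: "trade v 3 2 X (T i) (T j)" if "i \<in> {1..5}" "j \<in> {1..5}" "i \<noteq> j" for i j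
    using assms that by (auto simp: mway_trade_def)
  interpret five_way_trade X T
  proof
    show "finite X" "T 1 \<noteq> {#}" using trade[of 1 2] by (auto simp: trade_def)
    fix i :: nat assume i: "i \<in> {1..5}"
    \<comment> \<open>Any index other than \<open>i\<close>: the conditions on the blocks of
      \<open>T i\<close> are read off a trade between two different collections.\<close>
    define k :: nat where "k = (if i = 1 then 2 else 1)"
    have k: "k \<in> {1..5}" "i \<noteq> k" by (auto simp: k_def)
    show "B \<subseteq> X" "card B = 3" if "B \<in># T i" for B
      using trade[OF i k] that by (auto simp: trade_def)
    fix j :: nat assume j: "j \<in> {1..5}"
    show "i = j" if "B \<in># T i" "B \<in># T j" for B
    proof (rule ccontr)
      assume "i \<noteq> j"
      then have "set_mset (T i) \<inter> set_mset (T j) = {}" using trade[OF i j] by (simp add: trade_def)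
      then show False using that by blast
    qed
    show "size {#B \<in># T i. S \<subseteq> B#} = size {#B \<in># T j. S \<subseteq> B#}"
      if "S \<subseteq> X" "card S = 2" for S
    proof (cases "i = j")
      case False
      then show ?thesis using trade[OF i j] that by (simp add: trade_def)
    qed simp
  qed
  show ?thesis using volume_eq size_ge_12 by simp
qed

end
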